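(* Let $\Sigma_2=\{a,b\}$ and $\Sigma_1=\{c\}$. Then: (1) there exists an embedding from $\mathrm{sg}(\Sigma_1)\times\mathrm{sg}(\Sigma_1)$ into $\mathrm{UT}(2,\mathbb{N})$; (2) there exists an embedding from $\mathrm{fg}(\Sigma_2)\times\mathrm{fg}(\Sigma_1)$ into $\mathbb{Q}^{2\times2}$; (3) there exists an embedding from $\mathrm{sg}(\Sigma_2)\times\mathrm{fg}(\Sigma_1)$ into $\mathbb{Z}^{3\times3}$; (4) there exists an embedding from $\mathrm{fg}(\Sigma_2)\times\mathrm{sg}(\Sigma_1)$ into $\mathbb{Z}^{2\times2}$.
   Context: For an alphabet $\Sigma$, $\mathrm{sg}(\Sigma)$ is the free monoid of finite words over $\Sigma$ (including the empty word $\varepsilon$) under concatenation, and $\mathrm{fg}(\Sigma)$ is the free group on $\Sigma$ (reduced words over $\Sigma\cup\Sigma^{-1}$). Products such as $\mathrm{sg}(\Sigma_2)\times\mathrm{fg}(\Sigma_1)$ carry componentwise multiplication. For $\mathbb{K}\in\{\mathbb{N},\mathbb{Z},\mathbb{Q}\}$, $\mathbb{K}^{n\times n}$ is the multiplicative semigroup of $n\times n$ matrices with entries in $\mathbb{K}$, and $\mathrm{UT}(2,\mathbb{N})$ is the semigroup of $2\times2$ upper triangular matrices with entries in $\mathbb{N}$. An embedding is a map $\varphi$ with $\varphi(uv)=\varphi(u)\varphi(v)$ for all $u,v$ that is injective. *)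

theory Defs
  imports "HOL-Analysis.Finite_Cartesian_Product"
begin

text \<open>Alphabets: Sigma2 = {a,b}, Sigma1 = {c}.\<close>
datatype sigma2 = a | b
datatype sigma1 = c

text \<open>Free monoid sg(Sigma): all finite words (lists), multiplication = concatenation.\<close>
definition sg_carrier :: "'s list set" where "sg_carrier = UNIV"
definition sg_mult :: "'s list \<Rightarrow> 's list \<Rightarrow> 's list" where "sg_mult u v = u @ v"

text \<open>Free group fg(Sigma): letters (x, False) stand for x, (x, True) for x^{-1};
  elements are reduced words; multiplication is concatenation followed by free reduction.\<close>
fun reduced :: "('s \<times> bool) list \<Rightarrow> bool" where
  "reduced [] = True"
| "reduced [x] = True"
| "reduced (x # y # ys) = (\<not> (fst x = fst y \<and> snd x \<noteq> snd y) \<and> reduced (y # ys))"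

fun reduce :: "('s \<times> bool) list \<Rightarrow> ('s \<times> bool) list" where
  "reduce [] = []"
| "reduce (x # xs) = (case reduce xs of
      [] \<Rightarrow> [x]
    | y # ys \<Rightarrow> (if fst x = fst y \<and> snd x \<noteq> snd y then ys else x # y # ys))"

definition fg_carrier :: "('s \<times> bool) list set" where "fg_carrier = {w. reduced w}"
definition fg_mult :: "('s \<times> bool) list \<Rightarrow> ('s \<times> bool) list \<Rightarrow> ('s \<times> bool) list"
  where "fg_mult u v = reduce (u @ v)"

text \<open>Direct product with componentwise multiplication.\<close>
definition prod_mult :: "('a \<Rightarrow> 'a \<Rightarrow> 'a) \<Rightarrow> ('b \<Rightarrow> 'b \<Rightarrow> 'b) \<Rightarrow> 'a \<times> 'b \<Rightarrow> 'a \<times> 'b \<Rightarrow> 'a \<times> 'b"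
  where "prod_mult m1 m2 p q = (m1 (fst p) (fst q), m2 (snd p) (snd q))"

text \<open>Embedding of (C, m1) into the semigroup (D, m2): a multiplicative injective map C -> D.\<close>
definition embedding :: "'a set \<Rightarrow> ('a \<Rightarrow> 'a \<Rightarrow> 'a) \<Rightarrow> 'b set \<Rightarrow> ('b \<Rightarrow> 'b \<Rightarrow> 'b) \<Rightarrow> ('a \<Rightarrow> 'b) \<Rightarrow> bool"
  where "embedding C m1 D m2 \<phi> \<longleftrightarrow>
     \<phi> ` C \<subseteq> D \<and> (\<forall>u\<in>C. \<forall>v\<in>C. \<phi> (m1 u v) = m2 (\<phi> u) (\<phi> v)) \<and> inj_on \<phi> C"

text \<open>UT(2,N): 2x2 upper triangular matrices over nat (indices 0,1; entry (1,0) vanishes).\<close>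
definition UT2N :: "(nat ^ 2 ^ 2) set" where "UT2N = {M. M $ 1 $ 0 = 0}"

end

theory Submission
  imports Defs "HOL-Analysis.Determinants"
begin

text \<open>
  A word over the single letter c is determined by its length in the free monoid and by its
  exponent sum in the free group, and either can be recorded by a power of 2.  Words in the free
  monoid on a, b are recorded by the affine map x \<mapsto> 2^|w| x + (binary value of w).  Reduced
  words in the free group on a, b are separated by ping-pong with the matrices
  [[1, \<plusminus>3], [0, 1]] and [[1, 0], [\<plusminus>3, 1]]: a nonempty reduced word sends (1, 1) into a
  region determined by its first letter, and the four regions are disjoint and miss (1, 1).
  Since these matrices have determinant 1, the positive scalar in \<alpha> M is recovered from
  det (\<alpha> M) = \<alpha>^2, so a scalar power of 2 can carry the second factor of the product.
\<close>

primrec word_hom :: "('m \<Rightarrow> 'm \<Rightarrow> 'm) \<Rightarrow> 'm \<Rightarrow> ('l \<Rightarrow> 'm) \<Rightarrow> 'l list \<Rightarrow> 'm" where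
  "word_hom m e f [] = e"
| "word_hom m e f (x # w) = m (f x) (word_hom m e f w)"

lemma word_hom_append:
  assumes "monoid m e"
  shows "word_hom m e f (u @ v) = m (word_hom m e f u) (word_hom m e f v)"
proof -
  interpret monoid m e by fact
  show ?thesis by (induction u) (simp_all add: assoc)
qed

lemma word_hom_reduce:
  assumes "monoid m e" and inverse: "\<And>x s. m (f (x, s)) (f (x, \<not> s)) = e"
  shows "word_hom m e f (reduce w) = word_hom m e f w"
proof -
  interpret monoid m e by fact
  show ?thesis
  proof (induction w)
    case (Cons x w)
    show ?case
    proof (cases "reduce w")
      case (Cons y w')
      show ?thesis
      proof (cases "fst x = fst y \<and> snd x \<noteq> snd y")
        case True
        then have "m (f x) (f y) = e"
          using inverse[of "fst x" "snd x"] by (cases x; cases y) auto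
        have "word_hom m e f (x # w) = m (f x) (m (f y) (word_hom m e f w'))"
          using Cons.IH \<open>reduce w = y # w'\<close> by simp
        also have "\<dots> = word_hom m e f w'"
          using \<open>m (f x) (f y) = e\<close> by (simp flip: assoc)
        finally show ?thesis using True \<open>reduce w = y # w'\<close> by simp
      qed (use Cons.IH \<open>reduce w = y # w'\<close> in auto)
    qed (use Cons.IH in simp)
  qed simp
qed

lemma word_hom_fg_mult:
  assumes "monoid m e" and "\<And>x s. m (f (x, s)) (f (x, \<not> s)) = e"
  shows "word_hom m e f (fg_mult u v) = m (word_hom m e f u) (word_hom m e f v)"
  by (simp add: fg_mult_def word_hom_reduce[OF assms] word_hom_append[OF assms(1)])

lemma reduced_ConsD: "reduced (x # w) \<Longrightarrow> reduced w"
  by (cases w) auto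

lemma embedding_prodI:
  assumes "\<And>u v w z. \<lbrakk>u \<in> C1; v \<in> C1; w \<in> C2; z \<in> C2\<rbrakk> \<Longrightarrow>
      f (m1 u v) (m2 w z) = m (f u w) (f v z)"
    and "\<And>u v w z. \<lbrakk>u \<in> C1; v \<in> C1; w \<in> C2; z \<in> C2; f u w = f v z\<rbrakk> \<Longrightarrow>
      u = v \<and> w = z"
    and "\<And>u w. \<lbrakk>u \<in> C1; w \<in> C2\<rbrakk> \<Longrightarrow> f u w \<in> D"
  shows "embedding (C1 \<times> C2) (prod_mult m1 m2) D m (\<lambda>(u, w). f u w)"
  using assms unfolding embedding_def prod_mult_def inj_on_def by auto

lemma sigma1_eq: "(x :: sigma1) = y"
  by (cases x; cases y) simp

lemma sigma1_list_eq_replicate: "(w :: sigma1 list) = replicate (length w) c"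
  by (induction w) (auto simp: sigma1_eq)

lemma sigma1_list_eq_iff: "(u :: sigma1 list) = v \<longleftrightarrow> length u = length v"
  by (metis sigma1_list_eq_replicate)

lemma reduced_sigma1_eq_replicate:
  fixes w :: "(sigma1 \<times> bool) list"
  assumes "reduced w"
  shows "w = replicate (length w) (c, snd (hd w))"
  using assms
proof (induction w)
  case (Cons x w)
  show ?case
  proof (cases w)
    case (Cons y w')
    then have "snd y = snd x"
      using \<open>reduced (x # w)\<close> by (cases x; cases y) (auto simp: sigma1_eq)
    then show ?thesis
      using Cons.IH reduced_ConsD[OF \<open>reduced (x # w)\<close>] \<open>w = y # w'\<close>
      by (cases x) (auto simp: sigma1_eq)
  qed (cases x, auto simp: sigma1_eq)
qed simp

definition exponent_sum :: "('s \<times> bool) list \<Rightarrow> int" where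
  "exponent_sum = word_hom (+) 0 (\<lambda>x. if snd x then -1 else 1)"

lemma exponent_sum_fg_mult: "exponent_sum (fg_mult u v) = exponent_sum u + exponent_sum v"
  unfolding exponent_sum_def by (rule word_hom_fg_mult[OF add.monoid_axioms]) simp

lemma exponent_sum_replicate:
  "exponent_sum (replicate n (x, s)) = (if s then - int n else int n)"
  by (induction n) (auto simp: exponent_sum_def)

lemma inj_on_exponent_sum_sigma1:
  "inj_on (exponent_sum :: (sigma1 \<times> bool) list \<Rightarrow> int) fg_carrier"
proof (rule inj_onI)
  fix u v :: "(sigma1 \<times> bool) list"
  assume "u \<in> fg_carrier" "v \<in> fg_carrier" and sum_eq: "exponent_sum u = exponent_sum v"
  then have u: "u = replicate (length u) (c, snd (hd u))"
    and v: "v = replicate (length v) (c, snd (hd v))"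
    by (simp_all add: fg_carrier_def reduced_sigma1_eq_replicate)
  have "replicate m (c, s) = replicate n (c, t)"
    if "exponent_sum (replicate m (c, s)) = exponent_sum (replicate n (c, t))" for m n s t
    using that by (auto simp: exponent_sum_replicate split: if_splits)
  then show "u = v"
    using sum_eq u v by metis
qed

lemma monoid_matrix_mult: "monoid (**) (mat 1 :: 'a::semiring_1^'n^'n)"
  by unfold_locales (simp_all add: matrix_mul_assoc)

lemma mat_matrix_mult_nth: "(mat k ** A) $ i $ j = k * A $ i $ j"
  by (simp add: matrix_matrix_mult_def mat_def if_distrib if_distribR sum.delta cong: if_cong)

lemma matrix_mult_mat_nth: "(A ** mat k) $ i $ j = A $ i $ j * k"
  by (simp add: matrix_matrix_mult_def mat_def if_distrib if_distribR sum.delta' cong: if_cong)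

lemma scaled_matrix_mult:
  fixes A B :: "'a::comm_semiring_1^'n^'n"
  shows "(mat k ** A) ** (mat l ** B) = mat (k * l) ** (A ** B)"
proof -
  have "A ** mat l = mat l ** A"
    by (simp add: vec_eq_iff mat_matrix_mult_nth matrix_mult_mat_nth mult.commute)
  moreover have "mat k ** mat l = (mat (k * l) :: 'a^'n^'n)"
    by (simp add: vec_eq_iff mat_matrix_mult_nth) (simp add: mat_def)
  ultimately show ?thesis
    by (metis matrix_mul_assoc)
qed

lemma det_mat: "det (mat k :: 'a::comm_ring_1^'n^'n) = k ^ CARD('n)"
  by (simp add: det_diagonal mat_def)

lemma scaled_unimodular_matrix_eqD:
  fixes k l :: "'a::linordered_idom" and A B :: "'a^'n^'n"
  assumes eq: "mat k ** A = mat l ** B" and "det A = 1" "det B = 1" "0 < k" "0 < l"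
  shows "k = l \<and> A = B"
proof -
  have "k ^ CARD('n) = l ^ CARD('n)"
    using arg_cong[OF eq, of det] assms(2,3) by (simp add: det_mul det_mat)
  then have "k = l"
    using assms(4,5) by (simp add: power_eq_iff_eq_base)
  moreover have "A = B"
    using eq \<open>k = l\<close> assms(4) by (simp add: vec_eq_iff mat_matrix_mult_nth)
  ultimately show ?thesis ..
qed

text \<open>
  Sanov's generators have entry 2; with 3 every ping-pong inequality is strict, so the start
  vector (1, 1) lies in no region while each generator moves it into its own.
\<close>

fun sanov_gen :: "sigma2 \<times> bool \<Rightarrow> 'a::ring_1^2^2" where
  "sanov_gen (a, s) = vector [vector [1, if s then -3 else 3], vector [0, 1]]"
| "sanov_gen (b, s) = vector [vector [1, 0], vector [if s then -3 else 3, 1]]"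

definition sanov :: "(sigma2 \<times> bool) list \<Rightarrow> 'a::ring_1^2^2" where
  "sanov = word_hom (**) (mat 1) sanov_gen"

lemma sanov_gen_inverse: "sanov_gen (x, s) ** sanov_gen (x, \<not> s) = mat 1"
  by (cases x) (simp_all add: vec_eq_iff forall_2 matrix_matrix_mult_def sum_2 mat_def)

lemma sanov_Cons: "sanov (x # w) = sanov_gen x ** sanov w"
  by (simp add: sanov_def)

lemma sanov_fg_mult: "sanov (fg_mult u v) = sanov u ** sanov v"
  unfolding sanov_def by (rule word_hom_fg_mult[OF monoid_matrix_mult sanov_gen_inverse])

lemma det_sanov: "det (sanov w :: 'a::comm_ring_1^2^2) = 1"
proof (induction w)
  case (Cons x w)
  have "det (sanov_gen x :: 'a^2^2) = 1"
    by (cases x rule: sanov_gen.cases) (simp_all add: det_2)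
  then show ?case
    using Cons.IH by (simp add: sanov_Cons det_mul)
qed (simp add: sanov_def)

definition ping_pong_region :: "sigma2 \<times> bool \<Rightarrow> ('a::linordered_idom^2) set" where
  "ping_pong_region x = {v.
     (if fst x = a then \<bar>v$2\<bar> < \<bar>v$1\<bar> else \<bar>v$1\<bar> < \<bar>v$2\<bar>)
     \<and> (if snd x then v$1 * v$2 < 0 else 0 < v$1 * v$2)}"

lemma sanov_gen_maps_region:
  fixes v :: "'a::linordered_idom^2"
  assumes "v \<in> ping_pong_region y" and "\<not> (fst x = fst y \<and> snd x \<noteq> snd y)"
  shows "sanov_gen x *v v \<in> ping_pong_region x"
  using assms
  by (cases x rule: sanov_gen.cases; cases y rule: sanov_gen.cases)
     (auto simp: ping_pong_region_def matrix_vector_mult_def sum_2 zero_less_mult_iff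
        mult_less_0_iff abs_if split: if_splits)

lemma sanov_gen_start_in_region:
  "sanov_gen x *v vector [1, 1] \<in> (ping_pong_region x :: ('a::linordered_idom^2) set)"
  by (cases x rule: sanov_gen.cases) (auto simp: ping_pong_region_def matrix_vector_mult_def sum_2)

lemma start_notin_ping_pong_region:
  "vector [1, 1] \<notin> (ping_pong_region x :: ('a::linordered_idom^2) set)"
  by (simp add: ping_pong_region_def)

lemma sanov_reduced_in_region:
  "reduced (x # w) \<Longrightarrow>
     sanov (x # w) *v vector [1, 1] \<in> (ping_pong_region x :: ('a::linordered_idom^2) set)"
proof (induction w arbitrary: x)
  case Nil
  then show ?case by (simp add: sanov_def sanov_gen_start_in_region)
next
  case (Cons y w)
  then have "sanov (y # w) *v vector [1, 1] \<in> (ping_pong_region y :: ('a^2) set)"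
    using reduced_ConsD by blast
  moreover have "\<not> (fst x = fst y \<and> snd x \<noteq> snd y)"
    using Cons.prems by simp
  ultimately have
    "sanov_gen x *v (sanov (y # w) *v vector [1, 1]) \<in> (ping_pong_region x :: ('a^2) set)"
    by (rule sanov_gen_maps_region)
  then show ?case
    by (simp add: sanov_Cons matrix_vector_mul_assoc)
qed

lemma ping_pong_region_disjoint:
  assumes "v \<in> ping_pong_region x" and "v \<in> ping_pong_region y"
  shows "x = y"
proof -
  have "fst x = fst y"
    using assms by (cases "fst x"; cases "fst y") (auto simp: ping_pong_region_def)
  moreover have "snd x = snd y"
    using assms by (cases "snd x"; cases "snd y") (auto simp: ping_pong_region_def)
  ultimately show ?thesis
    by (simp add: prod_eq_iff)
qed

lemma sanov_Cons_cancel: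
  assumes "sanov (x # u) = (sanov (x # v) :: 'a::ring_1^2^2)"
  shows "sanov u = (sanov v :: 'a^2^2)"
proof -
  obtain g s where x: "x = (g, s)"
    by fastforce
  have left_inverse: "sanov_gen (g, \<not> s) ** sanov (x # w) = (sanov w :: 'a^2^2)"
    for w :: "(sigma2 \<times> bool) list"
    using sanov_gen_inverse[of g "\<not> s", where 'a = 'a] by (simp add: x sanov_Cons matrix_mul_assoc)
  show ?thesis
    using left_inverse[of u] left_inverse[of v] assms by simp
qed

lemma sanov_reduced_eqD:
  assumes "reduced u" and "reduced v" and "sanov u = (sanov v :: 'a::linordered_idom^2^2)"
  shows "u = v"
  using assms
proof (induction u arbitrary: v)
  case Nil
  show ?case
  proof (rule ccontr)
    assume "[] \<noteq> v"
    then obtain y v' where "v = y # v'"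
      by (cases v) auto
    then have "vector [1, 1] \<in> (ping_pong_region y :: ('a^2) set)"
      using Nil.prems sanov_reduced_in_region[of y v', where 'a = 'a] by (simp add: sanov_def)
    then show False
      using start_notin_ping_pong_region by blast
  qed
next
  case (Cons x u)
  have x_region: "sanov (x # u) *v vector [1, 1] \<in> (ping_pong_region x :: ('a^2) set)"
    using Cons.prems(1) by (rule sanov_reduced_in_region)
  show ?case
  proof (cases v)
    case Nil
    then have "vector [1, 1] \<in> (ping_pong_region x :: ('a^2) set)"
      using x_region Cons.prems(3) by (simp add: sanov_def)
    then show ?thesis
      using start_notin_ping_pong_region by blast
  next
    case (Cons y v')
    then have "sanov (x # u) *v vector [1, 1] \<in> (ping_pong_region y :: ('a^2) set)"
      using Cons.prems(2,3) sanov_reduced_in_region[of y v', where 'a = 'a] by simp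
    then have "x = y"
      using x_region ping_pong_region_disjoint by blast
    then have "sanov u = (sanov v' :: 'a^2^2)"
      using Cons.prems(3) \<open>v = y # v'\<close> sanov_Cons_cancel by blast
    then show ?thesis
      using Cons.IH[of v'] Cons.prems(1,2) \<open>v = y # v'\<close> \<open>x = y\<close> reduced_ConsD
      by blast
  qed
qed

lemma inj_on_sanov: "inj_on (sanov :: _ \<Rightarrow> 'a::linordered_idom^2^2) fg_carrier"
  by (auto intro: inj_onI sanov_reduced_eqD simp: fg_carrier_def)

fun binary_code :: "sigma2 list \<Rightarrow> int" where
  "binary_code [] = 0"
| "binary_code (x # w) = (if x = a then 0 else 1) + 2 * binary_code w"

lemma binary_code_append: "binary_code (u @ v) = binary_code u + 2 ^ length u * binary_code v"
  by (induction u) (simp_all add: algebra_simps)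

lemma binary_code_eqD:
  assumes "length u = length v" and "binary_code u = binary_code v"
  shows "u = v"
  using assms
proof (induction u arbitrary: v)
  case (Cons x u)
  then obtain y v' where v: "v = y # v'"
    by (cases v) auto
  have code_eq:
    "(if x = a then 0 else 1) + 2 * binary_code u = (if y = a then 0 else 1) + 2 * binary_code v'"
    using Cons.prems(2) v by simp
  have "x = y"
    using arg_cong[OF code_eq, of "\<lambda>n. n mod 2"] by (cases x; cases y) simp_all
  moreover have "binary_code u = binary_code v'"
    using arg_cong[OF code_eq, of "\<lambda>n. n div 2"] by (cases x; cases y) simp_all
  ultimately show ?case
    using Cons.IH[of v'] Cons.prems(1) v by simp
qed simp

text \<open>
  The affine matrix [[p, q], [0, 1]] on coordinates 1, 2 and the shear [[1, 0], [k, 1]] on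
  coordinates 2, 3 share only the fixed middle coordinate, so they multiply independently.
\<close>

definition affine_shear :: "'a::semiring_1 \<Rightarrow> 'a \<Rightarrow> 'a \<Rightarrow> 'a^3^3" where
  "affine_shear p q k = vector [vector [p, q, 0], vector [0, 1, 0], vector [0, k, 1]]"

lemma affine_shear_mult:
  "affine_shear p q k ** affine_shear p' q' k' = affine_shear (p * p') (p * q' + q) (k + k')"
  by (simp add: affine_shear_def vec_eq_iff forall_3 matrix_matrix_mult_def sum_3)

lemma affine_shear_eq_iff:
  "affine_shear p q k = affine_shear p' q' k' \<longleftrightarrow> p = p' \<and> q = q' \<and> k = k'"
  by (auto simp: affine_shear_def vec_eq_iff forall_3)

lemma embedding_diagonal_powers:
  "embedding (sg_carrier \<times> sg_carrier) (prod_mult sg_mult sg_mult) UT2N (**)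
     (\<lambda>(u :: sigma1 list, w :: sigma1 list).
        vector [vector [2 ^ length u, 0], vector [0, 2 ^ length w]] :: nat^2^2)"
  by (rule embedding_prodI)
     (auto simp: sg_mult_def power_add vec_eq_iff forall_2 matrix_matrix_mult_def sum_2
        sigma1_list_eq_iff UT2N_def vector_def)

lemma embedding_scaled_sanov_rat:
  "embedding (fg_carrier \<times> fg_carrier) (prod_mult fg_mult fg_mult) UNIV (**)
     (\<lambda>(u :: (sigma2 \<times> bool) list, w :: (sigma1 \<times> bool) list).
        mat (2 powi exponent_sum w) ** sanov u :: rat^2^2)"
proof (rule embedding_prodI)
  fix u v :: "(sigma2 \<times> bool) list" and w z :: "(sigma1 \<times> bool) list"
  assume carrier: "u \<in> fg_carrier" "v \<in> fg_carrier" "w \<in> fg_carrier" "z \<in> fg_carrier"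
  assume "mat (2 powi exponent_sum w) ** sanov u = (mat (2 powi exponent_sum z) ** sanov v :: rat^2^2)"
  then have "(2::rat) powi exponent_sum w = 2 powi exponent_sum z \<and> sanov u = (sanov v :: rat^2^2)"
    by (rule scaled_unimodular_matrix_eqD) (simp_all add: det_sanov)
  moreover have "strict_mono (\<lambda>k. (2::rat) powi k)"
    by (rule strict_monoI) (simp add: power_int_strict_increasing)
  ultimately show "u = v \<and> w = z"
    using carrier inj_on_sanov inj_on_exponent_sum_sigma1 by (auto simp: strict_mono_eq inj_on_def)
qed (simp_all add: sanov_fg_mult exponent_sum_fg_mult scaled_matrix_mult power_int_add)

lemma embedding_affine_shear:
  "embedding (sg_carrier \<times> fg_carrier) (prod_mult sg_mult fg_mult) UNIV (**)
     (\<lambda>(u :: sigma2 list, w :: (sigma1 \<times> bool) list).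
        affine_shear (2 ^ length u) (binary_code u) (exponent_sum w) :: int^3^3)"
proof (rule embedding_prodI)
  fix u v :: "sigma2 list" and w z :: "(sigma1 \<times> bool) list"
  assume "w \<in> fg_carrier" "z \<in> fg_carrier"
    and "affine_shear (2 ^ length u) (binary_code u) (exponent_sum w)
      = (affine_shear (2 ^ length v) (binary_code v) (exponent_sum z) :: int^3^3)"
  then show "u = v \<and> w = z"
    using binary_code_eqD inj_on_exponent_sum_sigma1 by (auto simp: affine_shear_eq_iff inj_on_def)
qed (simp_all add: sg_mult_def affine_shear_mult binary_code_append exponent_sum_fg_mult
       power_add ac_simps)

lemma embedding_scaled_sanov_int:
  "embedding (fg_carrier \<times> sg_carrier) (prod_mult fg_mult sg_mult) UNIV (**)
     (\<lambda>(u :: (sigma2 \<times> bool) list, w :: sigma1 list).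
        mat (2 ^ length w) ** sanov u :: int^2^2)"
proof (rule embedding_prodI)
  fix u v :: "(sigma2 \<times> bool) list" and w z :: "sigma1 list"
  assume "u \<in> fg_carrier" "v \<in> fg_carrier"
    and "mat (2 ^ length w) ** sanov u = (mat (2 ^ length z) ** sanov v :: int^2^2)"
  moreover from this(3) have "(2::int) ^ length w = 2 ^ length z \<and> sanov u = (sanov v :: int^2^2)"
    by (rule scaled_unimodular_matrix_eqD) (simp_all add: det_sanov)
  ultimately show "u = v \<and> w = z"
    using inj_on_sanov by (auto simp: sigma1_list_eq_iff inj_on_def)
qed (simp_all add: sg_mult_def sanov_fg_mult scaled_matrix_mult power_add)

theorem proposition5:
  shows "(\<exists>\<phi> :: sigma1 list \<times> sigma1 list \<Rightarrow> nat ^ 2 ^ 2.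
            embedding (sg_carrier \<times> sg_carrier) (prod_mult sg_mult sg_mult) UT2N (**) \<phi>)
       \<and> (\<exists>\<phi> :: (sigma2 \<times> bool) list \<times> (sigma1 \<times> bool) list \<Rightarrow> rat ^ 2 ^ 2.
            embedding (fg_carrier \<times> fg_carrier) (prod_mult fg_mult fg_mult) UNIV (**) \<phi>)
       \<and> (\<exists>\<phi> :: sigma2 list \<times> (sigma1 \<times> bool) list \<Rightarrow> int ^ 3 ^ 3.
            embedding (sg_carrier \<times> fg_carrier) (prod_mult sg_mult fg_mult) UNIV (**) \<phi>)
       \<and> (\<exists>\<phi> :: (sigma2 \<times> bool) list \<times> sigma1 list \<Rightarrow> int ^ 2 ^ 2.
            embedding (fg_carrier \<times> sg_carrier) (prod_mult fg_mult sg_mult) UNIV (**) \<phi>)"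
  using embedding_diagonal_powers embedding_scaled_sanov_rat embedding_affine_shear
    embedding_scaled_sanov_int
  by blast

end
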